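(* Consider the damaged fractional visco-elasto-plastic model described in the context, with Helmholtz free-energy density $\psi$, stress $\tau$ and total strain $\varepsilon$. The mechanical dissipation of the model, i.e. the left-hand side $-\dot\psi+\tau\dot\varepsilon$ of the Clausius-Duhem inequality, is positive (in the sense of $\ge 0$) and is given by $$\bigl(1-D(t)\bigr)\Bigl[\tau^Y\dot\gamma(t)+\mathcal{D}^{ve}_{mech}(\varepsilon^{ve})+\mathcal{D}^{vp}_{mech}(\alpha)\Bigr]-Y(\varepsilon^{ve},\alpha)\,\dot D(t)\ \ge\ 0 ,$$ so that the Clausius-Duhem inequality $-\dot\psi+\tau\dot\varepsilon\ge 0$ holds. Therefore the Helmholtz free-energy density, the stress-strain relationship and the evolution equations (for $\varepsilon^{vp}$, $\alpha$ and $D$) of the model are thermodynamically admissible.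
   Context: Material constants: $\mathbb{E},\mathbb{K},H,\tau^Y,S,s>0$ and $\beta_E,\beta_K\in(0,1)$. Dots denote time derivatives. The Caputo derivative of order $\beta\in(0,1)$ is ${}^C_0\mathcal{D}^\beta_t u(t)=\frac{1}{\Gamma(1-\beta)}\int_0^t\frac{\dot u(r)}{(t-r)^{\beta}}\,dr$. The process is isothermal and strain-driven. "Thermodynamically admissible" means that the Clausius-Duhem (dissipation) inequality $-\dot\psi+\tau\dot\varepsilon\ge0$ is satisfied. Relaxation spectra, for $z>0$: $\tilde E(z)=\dfrac{\mathbb{E}}{\Gamma(1-\beta_E)\Gamma(\beta_E)z^{\beta_E+1}}$ and $\tilde K(z)=\dfrac{\mathbb{K}}{\Gamma(1-\beta_K)\Gamma(\beta_K)z^{\beta_K+1}}$. Variables (functions of time $t$): total strain $\varepsilon$, visco-elastic strain $\varepsilon^{ve}$, visco-plastic strain $\varepsilon^{vp}$, hardening variable $\alpha\ge 0$, plastic slip $\gamma$ with slip rate $\dot\gamma$, and damage $D\in[0,1)$, which is monotonically increasing in time. All state and internal variables have homogeneous initial conditions. Undamaged free energies: $$\bar\psi^{ve}(\varepsilon^{ve})=\tfrac12\int_0^\infty\tilde E(z)\Bigl(\int_0^t e^{-(t-r)/z}\,\dot\varepsilon^{ve}(r)\,dr\Bigr)^2dz,$$ $$\bar\psi^{vp}(\alpha)=\tfrac12\int_0^\infty\tilde K(z)\Bigl(\int_0^t e^{-(t-r)/z}\,\dot\alpha(r)\,dr\Bigr)^2dz+\tfrac12H\alpha^2.$$ Helmholtz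 free-energy density: $\psi(\varepsilon^{ve},\alpha,D)=(1-D)\bigl(\bar\psi^{ve}(\varepsilon^{ve})+\bar\psi^{vp}(\alpha)\bigr)$. Damage energy release rates: $Y^{ve}=-\bar\psi^{ve}$, $Y^{vp}=-\bar\psi^{vp}$, $Y=Y^{ve}+Y^{vp}$. Visco-elastic and visco-plastic mechanical energy dissipation: $$\mathcal{D}^{ve}_{mech}(\varepsilon^{ve})=\int_0^\infty\frac{\tilde E(z)}{z}\Bigl(\int_0^t e^{-(t-r)/z}\,\dot\varepsilon^{ve}(r)\,dr\Bigr)^2dz,\qquad \mathcal{D}^{vp}_{mech}(\alpha)=\int_0^\infty\frac{\tilde K(z)}{z}\Bigl(\int_0^t e^{-(t-r)/z}\,\dot\alpha(r)\,dr\Bigr)^2dz.$$ Equations of the model: - Strain decomposition: $\varepsilon=\varepsilon^{ve}+\varepsilon^{vp}$. - Stress-strain relationship: $\tau=(1-D)\,\mathbb{E}\;{}^C_0\mathcal{D}^{\beta_E}_t(\varepsilon-\varepsilon^{vp})$. - Accumulated visco-plastic stress: $R=(1-D)\bigl[\mathbb{K}\;{}^C_0\mathcal{D}^{\beta_K}_t\alpha+H\alpha\bigr]$. - Yield function: $f=|\tau|-\bigl[(1-D)\tau^Y+R\bigr]$. - Evolution laws: $\dot\varepsilon^{vp}=\mathrm{sign}(\tau)\,\dot\gamma$, $\ \dot\alpha=\dot\gamma$, $\ \dot D=\dfrac{\dot\gamma}{1-D}\Bigl(-\dfrac{Y^{ve}}{S}\Bigr)^{s}$. - Kuhn-Tucker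 conditions: $\dot\gamma\ge0$, $f\le0$, $f\,\dot\gamma=0$. *)

theory Defs
  imports "HOL-Analysis.Analysis"
begin

text \<open>
  Processes live on a bounded time interval \<open>[0, T]\<close>; a process whose damage tends to 1 in finite
  time is covered by stopping it earlier. A dot is rendered by \<^const>\<open>deriv\<close>.

  Rates may jump (onset of yielding, load reversal), so state variables are only Lipschitz.
  The last clause of \<open>state_variable\<close> follows from the Lipschitz condition by Rademacher's theorem,
  which the library does not provide; it is spelled out so that the rates are visibly meaningful
  under the integrals below.
\<close>

definition state_variable :: "real \<Rightarrow> (real \<Rightarrow> real) \<Rightarrow> bool" where
  "state_variable T u \<longleftrightarrow>
     u 0 = 0 \<and>
     (\<exists>L. L-lipschitz_on {0..T} u) \<and>
     (AE t in lebesgue. t \<in> {0<..<T} \<longrightarrow> u differentiable at t)"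

text \<open>The times at which all rates of a given collection of variables exist.\<close>

definition regular_times :: "real \<Rightarrow> (real \<Rightarrow> real) set \<Rightarrow> real set" where
  "regular_times T U = {t \<in> {0<..<T}. \<forall>u\<in>U. u differentiable at t}"

definition caputo :: "real \<Rightarrow> (real \<Rightarrow> real) \<Rightarrow> real \<Rightarrow> real" where
  "caputo \<beta> u t = 1 / Gamma (1 - \<beta>) * (LINT r:{0..t}|lebesgue. deriv u r / (t - r) powr \<beta>)"

definition relaxation_spectrum :: "real \<Rightarrow> real \<Rightarrow> real \<Rightarrow> real" where
  "relaxation_spectrum C \<beta> z = C / (Gamma (1 - \<beta>) * Gamma \<beta> * z powr (\<beta> + 1))"

text \<open>The memory variable of the Maxwell element with relaxation time \<open>z\<close>.\<close>

definition memory :: "(real \<Rightarrow> real) \<Rightarrow> real \<Rightarrow> real \<Rightarrow> real" where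
  "memory u t z = (LINT r:{0..t}|lebesgue. exp (- (t - r) / z) * deriv u r)"

text \<open>The undamaged energies, as functions of time along the given histories.\<close>

definition psi_ve :: "real \<Rightarrow> real \<Rightarrow> (real \<Rightarrow> real) \<Rightarrow> real \<Rightarrow> real" where
  "psi_ve E \<beta>E eve t =
     1/2 * (LINT z:{0<..}|lebesgue. relaxation_spectrum E \<beta>E z * (memory eve t z)\<^sup>2)"

definition psi_vp :: "real \<Rightarrow> real \<Rightarrow> real \<Rightarrow> (real \<Rightarrow> real) \<Rightarrow> real \<Rightarrow> real" where
  "psi_vp K \<beta>K H \<alpha> t =
     1/2 * (LINT z:{0<..}|lebesgue. relaxation_spectrum K \<beta>K z * (memory \<alpha> t z)\<^sup>2)
     + 1/2 * H * (\<alpha> t)\<^sup>2"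

definition helmholtz ::
  "real \<Rightarrow> real \<Rightarrow> real \<Rightarrow> real \<Rightarrow> real \<Rightarrow>
   (real \<Rightarrow> real) \<Rightarrow> (real \<Rightarrow> real) \<Rightarrow> (real \<Rightarrow> real) \<Rightarrow> real \<Rightarrow> real" where
  "helmholtz E \<beta>E K \<beta>K H eve \<alpha> D t = (1 - D t) * (psi_ve E \<beta>E eve t + psi_vp K \<beta>K H \<alpha> t)"

definition release_ve :: "real \<Rightarrow> real \<Rightarrow> (real \<Rightarrow> real) \<Rightarrow> real \<Rightarrow> real" where
  "release_ve E \<beta>E eve t = - psi_ve E \<beta>E eve t"

definition release_vp :: "real \<Rightarrow> real \<Rightarrow> real \<Rightarrow> (real \<Rightarrow> real) \<Rightarrow> real \<Rightarrow> real" where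
  "release_vp K \<beta>K H \<alpha> t = - psi_vp K \<beta>K H \<alpha> t"

definition release_rate ::
  "real \<Rightarrow> real \<Rightarrow> real \<Rightarrow> real \<Rightarrow> real \<Rightarrow> (real \<Rightarrow> real) \<Rightarrow> (real \<Rightarrow> real) \<Rightarrow> real \<Rightarrow> real" where
  "release_rate E \<beta>E K \<beta>K H eve \<alpha> t = release_ve E \<beta>E eve t + release_vp K \<beta>K H \<alpha> t"

text \<open>Used with \<open>(E, \<beta>E, eve)\<close> for the visco-elastic and with \<open>(K, \<beta>K, \<alpha>)\<close> for the
  visco-plastic dissipation.\<close>

definition mech_dissipation :: "real \<Rightarrow> real \<Rightarrow> (real \<Rightarrow> real) \<Rightarrow> real \<Rightarrow> real" where
  "mech_dissipation C \<beta> u t =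
     (LINT z:{0<..}|lebesgue. relaxation_spectrum C \<beta> z / z * (memory u t z)\<^sup>2)"

text \<open>The left-hand side of the (isothermal) Clausius-Duhem inequality.\<close>

definition clausius_duhem_lhs ::
  "(real \<Rightarrow> real) \<Rightarrow> (real \<Rightarrow> real) \<Rightarrow> (real \<Rightarrow> real) \<Rightarrow> real \<Rightarrow> real" where
  "clausius_duhem_lhs \<psi> \<tau> \<epsilon> t = - deriv \<psi> t + \<tau> t * deriv \<epsilon> t"

definition thermodynamically_admissible ::
  "real set \<Rightarrow> (real \<Rightarrow> real) \<Rightarrow> (real \<Rightarrow> real) \<Rightarrow> (real \<Rightarrow> real) \<Rightarrow> bool" where
  "thermodynamically_admissible A \<psi> \<tau> \<epsilon> \<longleftrightarrow>
     (\<forall>t\<in>A. \<psi> differentiable at t \<and> \<epsilon> differentiable at t \<and> clausius_duhem_lhs \<psi> \<tau> \<epsilon> t \<ge> 0)"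

end

theory Submission
  imports Defs
begin

text \<open>
  Let \<open>u\<close> be a state variable with Lipschitz constant \<open>L\<close>. The integral that defines its memory
  variable \<open>m(t, z)\<close> is a priori differentiable in time only at the Lebesgue points of the rate,
  but integration by parts writes it as \<open>u(t)\<close> minus a \<open>C\<^sup>1\<close> function of time. Hence
  \<open>m\<close> is differentiable wherever \<open>u\<close> is, with the Maxwell equation \<open>m' = u' - m / z\<close>. Because
  \<open>m\<close> is bounded by \<open>L min(t, z)\<close> and is \<open>2L\<close>-Lipschitz in time, the stored energy can be
  differentiated under the integral over \<open>z\<close>, which gives
  \<open>u'(t) \<integral> C(z) m(t, z) dz - \<integral> C(z)/z m(t, z)\<^sup>2 dz\<close> for the spectrum \<open>C(z)\<close>. The last integral is
  the dissipation; by Fubini and the Gamma integral, the first one is the Caputo stress. In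
  the dissipation inequality the Caputo stresses then cancel against the stress power, and the yield
  condition \<open>f \<gamma>' = 0\<close> turns the remaining plastic power into \<open>(1 - D) \<tau>\<^sup>Y \<gamma>'\<close>.
\<close>

section \<open>Lipschitz functions as integrals of their rates\<close>

text \<open>Sampling at steps \<open>1 / Suc n\<close> exhibits a rate as the limit of a sequence,
  as dominated convergence and measurability of limits require. Truncation at \<open>b\<close> keeps
  the samples inside the interval on which \<open>u\<close> is controlled; it is eventually inactive
  because \<open>x < b\<close>.\<close>

lemma tendsto_forward_difference_quotient:
  fixes u :: "real \<Rightarrow> real"
  assumes "(u has_real_derivative d) (at x)" and "x < b"
  shows "(\<lambda>n. real (Suc n) * (u (min b (x + 1 / real (Suc n))) - u x)) \<longlonglongrightarrow> d"
proof -
  let ?h = "\<lambda>n. 1 / real (Suc n)"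
  have h: "filterlim ?h (at 0) sequentially"
    unfolding filterlim_at using LIMSEQ_inverse_real_of_nat by (auto simp: inverse_eq_divide)
  have "((\<lambda>h. (u (x + h) - u x) / h) \<longlongrightarrow> d) (at 0)"
    using assms(1) by (simp add: DERIV_def)
  from filterlim_compose[OF this h]
  have lim: "(\<lambda>n. (u (x + ?h n) - u x) / ?h n) \<longlonglongrightarrow> d" .
  have "?h \<longlonglongrightarrow> 0"
    using LIMSEQ_inverse_real_of_nat by (simp add: inverse_eq_divide)
  then have "eventually (\<lambda>n. ?h n < b - x) sequentially"
    by (rule order_tendstoD) (use assms(2) in simp)
  then have "eventually (\<lambda>n. (u (x + ?h n) - u x) / ?h n =
      real (Suc n) * (u (min b (x + ?h n)) - u x)) sequentially"
    by eventually_elim (simp add: min_def field_simps)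
  with lim show ?thesis
    by (rule Lim_transform_eventually)
qed

text \<open>The difference quotients are bounded by \<open>L\<close> and tend to \<open>w\<close>
  almost everywhere, so their integrals tend to the integral of \<open>w\<close>. The same integrals
  are difference quotients of an antiderivative of \<open>u\<close> at the two endpoints, and these
  tend to \<open>u b\<close> and \<open>u a\<close>.\<close>

lemma lipschitz_on_real_FTC:
  fixes u w :: "real \<Rightarrow> real"
  assumes ab: "a \<le> b" and lip: "L-lipschitz_on {a..b} u"
    and w [measurable]: "w \<in> borel_measurable borel"
    and der: "AE x in lborel. x \<in> {a<..<b} \<longrightarrow> (u has_real_derivative w x) (at x)"
  shows "set_integrable lborel {a..b} w" and "(LINT x:{a..b}|lborel. w x) = u b - u a"
proof -
  \<comment> \<open>Clamping the argument to [a, b] extends \<open>u\<close> to the whole line with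
    the same Lipschitz constant, so quotients that reach beyond \<open>b\<close> are still bounded
    by \<open>L\<close>.\<close>
  define g where "g = (\<lambda>x. u (max a (min b x)))"
  define d where "d = (\<lambda>n x. real (Suc n) * (g (x + 1 / real (Suc n)) - g x))"
  have L: "0 \<le> L"
    using lip by (rule lipschitz_on_nonneg)
  have g_lip: "\<bar>g x - g y\<bar> \<le> L * \<bar>x - y\<bar>" for x y
  proof -
    have "\<bar>g x - g y\<bar> \<le> L * \<bar>max a (min b x) - max a (min b y)\<bar>"
      unfolding g_def using lipschitz_onD[OF lip, of "max a (min b x)" "max a (min b y)"] ab
      by (simp add: dist_real_def)
    also have "\<dots> \<le> L * \<bar>x - y\<bar>"
      by (intro mult_left_mono L) (auto simp: max_def min_def)
    finally show ?thesis .
  qed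
  have g_cont: "continuous_on UNIV g"
    by (rule lipschitz_on_continuous_on[of L])
       (auto intro!: lipschitz_onI simp: g_lip dist_real_def L)
  then have [measurable]: "g \<in> borel_measurable borel"
    by (rule borel_measurable_continuous_onI)
  have [measurable]: "d n \<in> borel_measurable borel" for n
    unfolding d_def by measurable
  have d_bound: "\<bar>d n x\<bar> \<le> L" for n x
  proof -
    have "\<bar>d n x\<bar> = real (Suc n) * \<bar>g (x + 1 / real (Suc n)) - g x\<bar>"
      by (simp only: d_def abs_mult abs_of_nat)
    also have "\<dots> \<le> real (Suc n) * (L * \<bar>x + 1 / real (Suc n) - x\<bar>)"
      by (intro mult_left_mono g_lip) auto
    also have "\<dots> = L" by simp
    finally show ?thesis .
  qed
  have d_lim: "AE x in lborel. (\<lambda>n. indicator {a..b} x *\<^sub>R d n x) \<longlonglongrightarrow> indicator {a..b} x *\<^sub>R w x"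
  proof -
    have "AE x in lborel. x \<noteq> a" "AE x in lborel. x \<noteq> b"
      by (rule AE_lborel_singleton)+
    with der show ?thesis
    proof eventually_elim
      case (elim x)
      show ?case
      proof (cases "x \<in> {a..b}")
        case True
        then have "a < x" "x < b" using elim by auto
        moreover from this have "g x = u x" by (simp add: g_def)
        moreover have "g (x + 1 / real (Suc n)) = u (min b (x + 1 / real (Suc n)))" for n
        proof -
          have "0 < 1 / real (Suc n)" by simp
          with \<open>a < x\<close> \<open>x < b\<close> have "a \<le> min b (x + 1 / real (Suc n))" by linarith
          then show ?thesis by (simp only: g_def max.absorb2)
        qed
        ultimately show ?thesis
          using tendsto_forward_difference_quotient[of u "w x" x b] elim by (simp add: d_def)
      qed simp
    qed
  qed
  have bound_int: "integrable lborel (\<lambda>x. indicator {a..b} x * L)"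
    using borel_integrable_atLeastAtMost'[of a b "\<lambda>_. L"] by (simp add: set_integrable_def)
  show "set_integrable lborel {a..b} w"
    unfolding set_integrable_def
    by (rule integrable_dominated_convergence[OF _ _ bound_int d_lim])
       (use d_bound in \<open>auto simp: indicator_def\<close>)
  have lim1: "(\<lambda>n. LINT x|lborel. indicator {a..b} x *\<^sub>R d n x) \<longlonglongrightarrow> (LINT x:{a..b}|lborel. w x)"
    unfolding set_lebesgue_integral_def
    by (rule integral_dominated_convergence[OF _ _ bound_int d_lim])
       (use d_bound in \<open>auto simp: indicator_def\<close>)
  \<comment> \<open>The margins keep both \<open>x\<close> and \<open>x + 1 / Suc n\<close>, which
    is at most \<open>b + 1\<close>, in the interior of the enlarged interval for every
    \<open>x\<close> in [a, b].\<close>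
  obtain G where G: "\<And>x. x \<in> {a - 1..b + 2} \<Longrightarrow> (G has_vector_derivative g x) (at x within {a - 1..b + 2})"
    using antiderivative_continuous[OF continuous_on_subset[OF g_cont]] by auto
  have G': "(G has_real_derivative g x) (at x)" if "a - 1 < x" "x < b + 2" for x
    using G[of x] that by (simp add: has_real_derivative_iff_has_vector_derivative at_within_Icc_at)
  have d_int: "(LINT x|lborel. indicator {a..b} x *\<^sub>R d n x) =
      real (Suc n) * (G (b + 1 / real (Suc n)) - G b) - real (Suc n) * (G (a + 1 / real (Suc n)) - G a)"
    (is "_ = ?F b - ?F a") for n
  proof (rule integral_FTC_atLeastAtMost[OF ab, where F="?F"])
    fix x assume x: "a \<le> x" "x \<le> b"
    have "0 < 1 / real (Suc n)" "1 / real (Suc n) \<le> 1" by auto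
    with x have "a - 1 < x + 1 / real (Suc n)" "x + 1 / real (Suc n) < b + 2" by linarith+
    then have "((\<lambda>y. G (y + 1 / real (Suc n))) has_real_derivative g (x + 1 / real (Suc n))) (at x)"
      by (subst DERIV_shift[symmetric]) (rule G')
    moreover have "(G has_real_derivative g x) (at x)"
      using x by (intro G') auto
    ultimately have "(?F has_real_derivative d n x) (at x)"
      unfolding d_def by (intro DERIV_cmult DERIV_diff)
    then show "(?F has_vector_derivative d n x) (at x within {a..b})"
      unfolding has_real_derivative_iff_has_vector_derivative by (rule has_vector_derivative_at_within)
  next
    show "continuous_on {a..b} (d n)"
      unfolding d_def by (intro continuous_intros continuous_on_compose2[OF g_cont]) auto
  qed
  \<comment> \<open>The cut-off \<open>c + 2\<close> is never active, since the steps are at most 1;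
    the truncated limit lemma therefore applies to the plain quotient.\<close>
  have quot: "(\<lambda>n. real (Suc n) * (G (c + 1 / real (Suc n)) - G c)) \<longlonglongrightarrow> g c" if "c \<in> {a..b}" for c
  proof -
    have "1 / real (Suc n) \<le> 1" for n by simp
    then have "min (c + 2) (c + 1 / real (Suc n)) = c + 1 / real (Suc n)" for n
      by (intro min.absorb2) (meson add_left_mono order.trans one_le_numeral)
    with tendsto_forward_difference_quotient[OF G', of c "c + 2"] that show ?thesis by simp
  qed
  have "(\<lambda>n. LINT x|lborel. indicator {a..b} x *\<^sub>R d n x) \<longlonglongrightarrow> g b - g a"
    unfolding d_int by (intro tendsto_diff quot) (use ab in auto)
  with lim1 have "(LINT x:{a..b}|lborel. w x) = g b - g a"
    by (rule LIMSEQ_unique)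
  then show "(LINT x:{a..b}|lborel. w x) = u b - u a"
    using ab by (simp add: g_def)
qed

text \<open>Where \<open>u\<close> is not differentiable, \<open>deriv u\<close> carries no
  information. The function \<open>w\<close> is a Borel version of the rate that is bounded by
  \<open>L\<close> everywhere, so it can be used under integrals over the whole line.\<close>

lemma state_variable_rate:
  assumes sv: "state_variable T u"
  obtains L w where "L-lipschitz_on {0..T} u" and "w \<in> borel_measurable borel"
    and "\<And>x. \<bar>w x\<bar> \<le> L"
    and "\<And>x. x \<in> {0<..<T} \<Longrightarrow> u differentiable at x \<Longrightarrow> deriv u x = w x"
    and "AE x in lborel. x \<in> {0..T} \<longrightarrow> (u has_real_derivative w x) (at x)"
proof -
  obtain L where lip: "L-lipschitz_on {0..T} u"
    using sv by (auto simp: state_variable_def)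
  have L: "0 \<le> L"
    using lip by (rule lipschitz_on_nonneg)
  define g where "g = (\<lambda>x. if x \<in> {0..T} then u x else 0)"
  have "continuous_on {0..T} u"
    using lip by (rule lipschitz_on_continuous_on)
  then have [measurable]: "g \<in> borel_measurable borel"
    unfolding g_def by (intro borel_measurable_continuous_on_if) auto
  define d where "d = (\<lambda>x n. real (Suc n) * (g (min T (x + 1 / real (Suc n))) - g x))"
  \<comment> \<open>\<open>lim\<close> is unspecified where the quotients diverge. Clamping to
    [-L, L] enforces the bound there and changes nothing where \<open>u\<close> has a derivative,
    which is itself at most \<open>L\<close> in modulus.\<close>
  define w where "w = (\<lambda>x. max (- L) (min L (lim (d x))))"
  have [measurable]: "(\<lambda>x. d x n) \<in> borel_measurable borel" for n
    unfolding d_def by measurable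
  have "w \<in> borel_measurable borel"
    unfolding w_def by measurable
  moreover have "\<bar>w x\<bar> \<le> L" for x
    using L by (auto simp: w_def)
  moreover have deriv_w: "deriv u x = w x" if x: "x \<in> {0<..<T}" and diff: "u differentiable at x" for x
  proof -
    have der: "(u has_real_derivative deriv u x) (at x)"
      using diff by (simp add: DERIV_deriv_iff_real_differentiable)
    have d_eq: "d x = (\<lambda>n. real (Suc n) * (u (min T (x + 1 / real (Suc n))) - u x))"
      using x by (auto simp: d_def g_def min_def)
    have lim: "d x \<longlonglongrightarrow> deriv u x"
      using tendsto_forward_difference_quotient[OF der, of T] x by (simp add: d_eq)
    have "\<bar>d x n\<bar> \<le> L" for n
    proof -
      have "\<bar>u (min T (x + 1 / real (Suc n))) - u x\<bar> \<le> L * \<bar>min T (x + 1 / real (Suc n)) - x\<bar>"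
        using lipschitz_onD[OF lip, of "min T (x + 1 / real (Suc n))" x] x by (simp add: dist_real_def)
      also have "\<dots> \<le> L * (1 / real (Suc n))"
        by (intro mult_left_mono L) (use x in \<open>auto simp: min_def\<close>)
      finally have "real (Suc n) * \<bar>u (min T (x + 1 / real (Suc n))) - u x\<bar> \<le> real (Suc n) * (L * (1 / real (Suc n)))"
        by (intro mult_left_mono) auto
      also have "\<dots> = L" by simp
      finally show ?thesis
        by (simp only: d_eq abs_mult abs_of_nat)
    qed
    then have "\<bar>deriv u x\<bar> \<le> L"
      by (intro LIMSEQ_le_const2[OF tendsto_rabs[OF lim]]) auto
    moreover have "lim (d x) = deriv u x"
      using lim by (rule limI)
    ultimately show ?thesis
      by (auto simp: w_def)
  qed
  moreover have "AE x in lborel. x \<in> {0..T} \<longrightarrow> (u has_real_derivative w x) (at x)"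
  proof -
    have "AE x in lborel. x \<in> {0<..<T} \<longrightarrow> u differentiable at x"
      using sv by (simp add: state_variable_def AE_completion_iff)
    moreover have "AE x in lborel. x \<noteq> 0" "AE x in lborel. x \<noteq> T"
      by (rule AE_lborel_singleton)+
    ultimately show ?thesis
    proof eventually_elim
      case (elim x)
      show ?case
      proof
        assume "x \<in> {0..T}"
        then have "x \<in> {0<..<T}" and "u differentiable at x" using elim by auto
        then show "(u has_real_derivative w x) (at x)"
          using deriv_w by (metis DERIV_deriv_iff_real_differentiable)
      qed
    qed
  qed
  ultimately show ?thesis
    using that[OF lip] by blast
qed

section \<open>Exponential memory and the relaxation spectrum\<close>

text \<open>Makes the product of the exponential kernel with a history Lipschitz, so that it can be
  recovered from its rate in the integration by parts.\<close>

lemma lipschitz_on_mult_bounded: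
  fixes f g :: "real \<Rightarrow> real"
  assumes f: "Lf-lipschitz_on X f" and g: "Lg-lipschitz_on X g"
    and bf: "\<And>x. x \<in> X \<Longrightarrow> \<bar>f x\<bar> \<le> Bf" and bg: "\<And>x. x \<in> X \<Longrightarrow> \<bar>g x\<bar> \<le> Bg"
    and nonneg: "0 \<le> Bf" "0 \<le> Bg"
  shows "(Bf * Lg + Bg * Lf)-lipschitz_on X (\<lambda>x. f x * g x)"
proof (rule lipschitz_onI)
  fix x y assume xy: "x \<in> X" "y \<in> X"
  have "\<bar>f x * g x - f y * g y\<bar> = \<bar>f x * (g x - g y) + g y * (f x - f y)\<bar>"
    by (simp add: algebra_simps)
  also have "\<dots> \<le> \<bar>f x\<bar> * \<bar>g x - g y\<bar> + \<bar>g y\<bar> * \<bar>f x - f y\<bar>"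
    using abs_triangle_ineq by (metis abs_mult)
  also have "\<dots> \<le> Bf * (Lg * \<bar>x - y\<bar>) + Bg * (Lf * \<bar>x - y\<bar>)"
    using lipschitz_onD[OF f xy] lipschitz_onD[OF g xy] bf bg xy nonneg
    by (intro add_mono mult_mono) (auto simp: dist_real_def)
  finally show "dist (f x * g x) (f y * g y) \<le> (Bf * Lg + Bg * Lf) * dist x y"
    by (simp add: dist_real_def algebra_simps)
qed (use nonneg lipschitz_on_nonneg[OF f] lipschitz_on_nonneg[OF g] in auto)

lemma borel_measurable_exp_memory [measurable]:
  fixes w :: "real \<Rightarrow> real"
  assumes [measurable]: "w \<in> borel_measurable borel"
  shows "(\<lambda>z. LINT r:{0..t}|lborel. exp (- (t - r) / z) * w r) \<in> borel_measurable borel"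
  unfolding set_lebesgue_integral_def by measurable

lemma exp_memory_integrable:
  fixes w :: "real \<Rightarrow> real"
  assumes [measurable]: "w \<in> borel_measurable borel" and w: "\<And>r. \<bar>w r\<bar> \<le> L" and z: "0 < z"
  shows "set_integrable lborel {0..t} (\<lambda>r. exp (- (t - r) / z) * w r)"
proof -
  have "set_integrable lborel {0..t} (\<lambda>r. L)"
    by (intro borel_integrable_atLeastAtMost') simp
  then show ?thesis
    unfolding set_integrable_def
  proof (rule Bochner_Integration.integrable_bound)
    have "exp (- (t - r) / z) * \<bar>w r\<bar> \<le> 1 * L" if "r \<le> t" for r
      using that z w[of r] by (intro mult_mono) (auto simp: field_simps)
    moreover have "L \<le> \<bar>L\<bar>" by simp
    ultimately show "AE r in lborel. norm (indicator {0..t} r *\<^sub>R (exp (- (t - r) / z) * w r))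
        \<le> norm (indicator {0..t} r *\<^sub>R L)"
      by (intro AE_I2) (auto simp: indicator_def abs_mult, fastforce intro: order.trans)
  qed measurable
qed

text \<open>The kernel is at most 1, which gives \<open>L * t\<close>, and its integral is at most
  \<open>z\<close>, which gives \<open>L * z\<close>. Both regimes matter: the second controls the
  spectrum near 0, the first controls it at infinity.\<close>

lemma exp_memory_bound:
  fixes w :: "real \<Rightarrow> real"
  assumes [measurable]: "w \<in> borel_measurable borel" and w: "\<And>r. \<bar>w r\<bar> \<le> L"
    and z: "0 < z" and t: "0 \<le> t"
  shows "\<bar>LINT r:{0..t}|lborel. exp (- (t - r) / z) * w r\<bar> \<le> L * min t z"
proof -
  have L: "0 \<le> L" using w[of 0] by simp
  have int: "set_integrable lborel {0..t} (\<lambda>r. exp (- (t - r) / z) * L)"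
    by (rule exp_memory_integrable[OF _ _ z, where L=L]) (use L in auto)
  have "\<bar>LINT r:{0..t}|lborel. exp (- (t - r) / z) * w r\<bar> \<le>
      (LINT r:{0..t}|lborel. \<bar>exp (- (t - r) / z) * w r\<bar>)"
    using set_integral_norm_bound[OF exp_memory_integrable[OF assms(1) w z, of t]] by simp
  also have "\<dots> \<le> (LINT r:{0..t}|lborel. exp (- (t - r) / z) * L)"
    using exp_memory_integrable[OF assms(1) w z, of t] int
    by (intro set_integral_mono set_integrable_abs) (auto simp: abs_mult w)
  also have "\<dots> = L * z * exp (- (t - t) / z) - L * z * exp (- (t - 0) / z)"
    unfolding set_lebesgue_integral_def
  proof (rule integral_FTC_atLeastAtMost[OF t, where F="\<lambda>r. L * z * exp (- (t - r) / z)"])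
    show "((\<lambda>r. L * z * exp (- (t - r) / z)) has_vector_derivative exp (- (t - x) / z) * L) (at x within {0..t})" for x
      unfolding has_real_derivative_iff_has_vector_derivative[symmetric]
      using z by (auto intro!: derivative_eq_intros)
  qed (use z in \<open>auto intro!: continuous_intros\<close>)
  also have "\<dots> = L * (z * (1 - exp (- (t / z))))"
    by (simp add: algebra_simps)
  also have "\<dots> \<le> L * min t z"
  proof (rule mult_left_mono[OF _ L])
    have "1 - exp (- (t / z)) \<le> t / z" using exp_ge_add_one_self[of "- (t / z)"] by linarith
    then have "z * (1 - exp (- (t / z))) \<le> z * (t / z)" using z by (intro mult_left_mono) auto
    then show "z * (1 - exp (- (t / z))) \<le> min t z" using z by (simp add: algebra_simps)
  qed
  finally show ?thesis .
qed

section \<open>Integrals against the relaxation spectrum\<close>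

lemma relaxation_spectrum_measurable [measurable]:
  "relaxation_spectrum C \<beta> \<in> borel_measurable borel"
  unfolding relaxation_spectrum_def[abs_def] by measurable

lemma relaxation_spectrum_nonneg:
  assumes "0 < C" "\<beta> \<in> {0<..<1}"
  shows "0 \<le> relaxation_spectrum C \<beta> z"
  using assms by (auto simp: relaxation_spectrum_def intro!: divide_nonneg_nonneg mult_nonneg_nonneg)

text \<open>Up to constants the integrand is \<open>z powr (- \<beta>)\<close> below
  \<open>T\<close>, integrable at 0 since \<beta> < 1, and \<open>z powr (- \<beta> - 1)\<close>
  above \<open>T\<close>, integrable at infinity since \<beta> > 0. It is the dominating function
  for all later integrals over \<open>z\<close>.\<close>

lemma relaxation_spectrum_min_integrable:
  assumes \<beta>: "\<beta> \<in> {0<..<1}" and T: "0 < T"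
  shows "set_integrable lborel {0<..} (\<lambda>z. relaxation_spectrum C \<beta> z * min T z)"
proof -
  define k where "k = C / (Gamma (1 - \<beta>) * Gamma \<beta>)"
  have "set_integrable lebesgue {0..T} (\<lambda>z. z powr (- \<beta>))"
    using \<beta> T by (intro nonnegative_absolutely_integrable_1 integrable_on_powr_from_0) auto
  then have "set_integrable lborel {0..T} (\<lambda>z. z powr (- \<beta>))"
    unfolding set_integrable_def by (subst (asm) integrable_completion) auto
  then have "set_integrable lborel {0<..T} (\<lambda>z. k * z powr (- \<beta>))"
    by (intro set_integrable_mult_right) (auto intro: set_integrable_subset)
  then have near: "set_integrable lborel {0<..T} (\<lambda>z. relaxation_spectrum C \<beta> z * min T z)"
    by (rule set_integrable_cong[THEN iffD1, rotated 3])
       (auto simp: relaxation_spectrum_def k_def powr_add powr_minus field_simps)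
  have "set_integrable lebesgue {T..} (\<lambda>z. z powr (- \<beta> - 1))"
    using \<beta> T has_integral_powr_to_inf[of "- \<beta> - 1" T]
    by (intro nonnegative_absolutely_integrable_1) auto
  then have "set_integrable lborel {T..} (\<lambda>z. z powr (- \<beta> - 1))"
    unfolding set_integrable_def by (subst (asm) integrable_completion) auto
  then have "set_integrable lborel {T<..} (\<lambda>z. k * T * z powr (- \<beta> - 1))"
    by (intro set_integrable_mult_right) (auto intro: set_integrable_subset)
  then have far: "set_integrable lborel {T<..} (\<lambda>z. relaxation_spectrum C \<beta> z * min T z)"
    by (rule set_integrable_cong[THEN iffD1, rotated 3])
       (use T in \<open>auto simp: relaxation_spectrum_def k_def powr_add powr_minus powr_diff field_simps\<close>)
  have "{0<..} = {0<..T} \<union> {T<..}" using T by auto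
  with set_integrable_Un[OF near far] show ?thesis by simp
qed

text \<open>The substitution \<open>y = x / z\<close> turns the integral into the Gamma integral;
  the factor \<open>Gamma \<beta>\<close> in the spectrum cancels and the Caputo kernel
  remains.\<close>

lemma relaxation_spectrum_exp_integral:
  assumes \<beta>: "\<beta> \<in> {0<..<1}" and x: "0 < x"
  shows "(LINT z:{0<..}|lborel. relaxation_spectrum C \<beta> z * exp (- x / z)) =
    C / Gamma (1 - \<beta>) * x powr (- \<beta>)"
proof -
  define F where "F = (\<lambda>y::real. y powr (\<beta> - 1) / exp y)"
  have "(F has_integral Gamma \<beta>) {0..}"
    unfolding F_def by (rule Gamma_integral_real) (use \<beta> in auto)
  then have "(F has_integral Gamma \<beta>) {0<..}"
    by (subst has_integral_spike_set_eq) (auto intro: negligible_subset[of "{0}"])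
  then have F: "F absolutely_integrable_on {0<..} \<and> integral {0<..} F = Gamma \<beta>"
    by (auto simp: F_def has_integral_iff intro!: nonnegative_absolutely_integrable_1)
  \<comment> \<open>The substitution is an involution of the open half line: the preimage of
    \<open>y\<close> is \<open>x / y\<close>.\<close>
  have img: "(\<lambda>z. x / z) ` {0<..} = {0<..}"
  proof (intro equalityI subsetI)
    fix y :: real assume "y \<in> {0<..}"
    then show "y \<in> (\<lambda>z. x / z) ` {0<..}"
      using x by (intro image_eqI[of _ _ "x / y"]) auto
  qed (use x in auto)
  \<comment> \<open>The factor in front of \<open>F (x / z)\<close> is the modulus of the derivative
    of \<open>x / z\<close>.\<close>
  have cov: "(\<lambda>z. \<bar>- x / z\<^sup>2\<bar> * F (x / z)) absolutely_integrable_on {0<..} \<and>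
      integral {0<..} (\<lambda>z. \<bar>- x / z\<^sup>2\<bar> * F (x / z)) = Gamma \<beta>"
    by (subst has_absolute_integral_change_of_variables_1')
       (use x F img in \<open>auto simp: power2_eq_square inj_on_def intro!: derivative_eq_intros\<close>)
  have eq: "\<bar>- x / z\<^sup>2\<bar> * F (x / z) = x powr \<beta> * (z powr (- \<beta> - 1) * exp (- x / z))"
    if "z \<in> {0<..}" for z
  proof -
    have z: "0 < z" using that by simp
    have "x powr (\<beta> - 1) = x powr \<beta> / x" "z powr (\<beta> - 1) = z powr \<beta> / z"
      "z powr (- \<beta> - 1) = 1 / (z powr \<beta> * z)"
      using x z by (simp_all add: powr_diff powr_minus divide_inverse)
    then have F: "F (x / z) = x powr \<beta> / x / (z powr \<beta> / z) / exp (x / z)"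
      and rhs: "z powr (- \<beta> - 1) * exp (- x / z) = 1 / (z powr \<beta> * z) / exp (x / z)"
      using x z by (simp add: F_def powr_divide, simp add: exp_minus divide_inverse)
    show ?thesis
      unfolding F rhs using x z by (simp add: power2_eq_square)
  qed
  have ai: "(\<lambda>z. x powr \<beta> * (z powr (- \<beta> - 1) * exp (- x / z))) absolutely_integrable_on {0<..}"
    by (rule set_integrable_cong[THEN iffD1, OF refl refl _ cov[THEN conjunct1]]) (rule eq)
  have "integral {0<..} (\<lambda>z. x powr \<beta> * (z powr (- \<beta> - 1) * exp (- x / z))) = Gamma \<beta>"
    by (rule trans[OF integral_cong cov[THEN conjunct2]]) (rule eq[symmetric])
  then have "Gamma \<beta> = (LINT z:{0<..}|lebesgue. x powr \<beta> * (z powr (- \<beta> - 1) * exp (- x / z)))"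
    using set_lebesgue_integral_eq_integral(2)[OF ai] by (simp only:)
  also have "\<dots> = (LINT z:{0<..}|lborel. x powr \<beta> * (z powr (- \<beta> - 1) * exp (- x / z)))"
    unfolding set_lebesgue_integral_def by (rule integral_completion) measurable
  finally have *: "x powr \<beta> * (LINT z:{0<..}|lborel. z powr (- \<beta> - 1) * exp (- x / z)) = Gamma \<beta>"
    by simp
  have "x powr \<beta> \<noteq> 0" using x by simp
  with * have I: "(LINT z:{0<..}|lborel. z powr (- \<beta> - 1) * exp (- x / z)) = Gamma \<beta> / x powr \<beta>"
    by (metis nonzero_mult_div_cancel_left)
  have "(LINT z:{0<..}|lborel. relaxation_spectrum C \<beta> z * exp (- x / z)) =
     (LINT z:{0<..}|lborel. C / (Gamma (1 - \<beta>) * Gamma \<beta>) * (z powr (- \<beta> - 1) * exp (- x / z)))"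
    by (rule set_lebesgue_integral_cong)
       (auto simp: relaxation_spectrum_def powr_add powr_minus powr_diff field_simps)
  also have "\<dots> = C / (Gamma (1 - \<beta>) * Gamma \<beta>) * (Gamma \<beta> / x powr \<beta>)"
    by (simp only: set_integral_mult_right I)
  also have "\<dots> = C / Gamma (1 - \<beta>) * x powr (- \<beta>)"
  proof -
    have "0 < Gamma \<beta>" using \<beta> by (intro Gamma_real_pos) auto
    then show ?thesis by (simp add: powr_minus field_simps)
  qed
  finally show ?thesis .
qed

section \<open>The memory variable of a Lipschitz history\<close>

text \<open>Pairs a history with a bounded Borel version of its rate. Integrals of
  \<open>deriv u\<close> over Lebesgue measure can then be computed with \<open>w\<close> over
  \<open>lborel\<close>, where the product measure and Fubini are available.\<close>

locale lipschitz_history =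
  fixes T L :: real and u w :: "real \<Rightarrow> real"
  assumes u_0: "u 0 = 0"
    and lip: "L-lipschitz_on {0..T} u"
    and rate_measurable [measurable]: "w \<in> borel_measurable borel"
    and rate_bound: "\<And>x. \<bar>w x\<bar> \<le> L"
    and deriv_eq_rate: "\<And>x. x \<in> {0<..<T} \<Longrightarrow> u differentiable at x \<Longrightarrow> deriv u x = w x"
    and rate_AE: "AE x in lborel. x \<in> {0..T} \<longrightarrow> (u has_real_derivative w x) (at x)"
begin

lemma L_nonneg: "0 \<le> L"
  using lip by (rule lipschitz_on_nonneg)

lemma u_cont: "continuous_on {0..T} u"
  using lip by (rule lipschitz_on_continuous_on)

text \<open>A derivative at an interior point depends only on values nearby, so agreement of
  \<open>v\<close> with \<open>u\<close> on the open interval suffices. This freedom is for the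
  strain difference in the stress law, which is known to equal the visco-elastic strain only on
  [0, T].\<close>

lemma deriv_integral_eq_rate_integral:
  assumes t: "t \<le> T" and v: "\<And>r. r \<in> {0<..<t} \<Longrightarrow> v r = u r"
    and [measurable]: "h \<in> borel_measurable borel"
  shows "(LINT r:{0..t}|lebesgue. h r * deriv v r) = (LINT r:{0..t}|lborel. h r * w r)"
proof -
  let ?f = "\<lambda>r. indicator {0..t} r *\<^sub>R (h r * w r)" and ?g = "\<lambda>r. indicator {0..t} r *\<^sub>R (h r * deriv v r)"
  have meas: "?f \<in> borel_measurable lebesgue"
    by (rule measurable_completion) measurable
  have deriv_v: "deriv v r = w r" if "r \<in> {0<..<t}" "(u has_real_derivative w r) (at r)" for r
  proof (rule DERIV_imp_deriv)
    show "(v has_real_derivative w r) (at r)"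
      using that(2) open_greaterThanLessThan that(1)
      by (rule has_field_derivative_transform_within_open) (rule v[symmetric])
  qed
  have "AE r in lborel. r \<noteq> 0" "AE r in lborel. r \<noteq> t"
    by (rule AE_lborel_singleton)+
  with rate_AE have "AE r in lborel. ?f r = ?g r"
    by eventually_elim (use t deriv_v in \<open>auto simp: indicator_def\<close>)
  then have AE: "AE r in lebesgue. ?f r = ?g r"
    by (rule AE_completion)
  have "(LINT r|lebesgue. ?f r) = (LINT r|lebesgue. ?g r)"
    by (rule integral_cong_AE[OF meas borel_measurable_AE[OF meas AE] AE])
  moreover have "(LINT r|lebesgue. ?f r) = (LINT r|lborel. ?f r)"
    by (rule integral_completion) measurable
  ultimately show ?thesis
    by (simp add: set_lebesgue_integral_def)
qed

lemma memory_eq: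
  "t \<le> T \<Longrightarrow> memory u t z = (LINT r:{0..t}|lborel. exp (- (t - r) / z) * w r)"
  unfolding memory_def by (rule deriv_integral_eq_rate_integral) auto

lemma caputo_eq:
  assumes "t \<le> T" "\<And>r. r \<in> {0<..<t} \<Longrightarrow> v r = u r"
  shows "caputo \<beta> v t = 1 / Gamma (1 - \<beta>) * (LINT r:{0..t}|lborel. (t - r) powr (- \<beta>) * w r)"
  using deriv_integral_eq_rate_integral[OF assms, of "\<lambda>r. (t - r) powr (- \<beta>)"]
  by (simp add: caputo_def powr_minus_divide)

section \<open>Bounds, integration by parts and time derivative of the memory variable\<close>

lemma memory_measurable:
  assumes "t \<le> T"
  shows "memory u t \<in> borel_measurable borel"
proof -
  have "memory u t = (\<lambda>z. LINT r:{0..t}|lborel. exp (- (t - r) / z) * w r)"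
    using memory_eq[OF assms] by (rule ext)
  then show ?thesis
    by (simp only:) (rule borel_measurable_exp_memory[OF rate_measurable])
qed

lemma memory_bound:
  assumes "t \<in> {0..T}" "0 < z"
  shows "\<bar>memory u t z\<bar> \<le> L * min t z"
  using assms by (simp only: memory_eq atLeastAtMost_iff) (intro exp_memory_bound rate_measurable rate_bound; simp)

text \<open>The exponentially weighted moving average of \<open>u\<close> with relaxation time
  \<open>z\<close>. The factor depending on \<open>t\<close> is pulled out of the integral, so that
  the time derivative follows from the product rule and the fundamental theorem for the continuous
  integrand.\<close>

definition delay :: "real \<Rightarrow> real \<Rightarrow> real" where
  "delay t z = exp (- t / z) / z * integral {0..t} (\<lambda>r. exp (r / z) * u r)"

text \<open>The rate of \<open>e r * u r\<close> is \<open>e r * w r + e r / z * u r\<close>.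
  Integrating it over [0, t] leaves only the boundary term \<open>u t\<close>, because
  \<open>e t = 1\<close> and \<open>u 0 = 0\<close>.\<close>

lemma memory_by_parts:
  assumes t: "t \<in> {0..T}" and z: "0 < z"
  shows "memory u t z = u t - delay t z"
proof -
  define e where "e = (\<lambda>r. exp (- (t - r) / z))"
  \<comment> \<open>The fundamental theorem asks for a rate that is Borel on the whole line, whereas
    \<open>u\<close> is controlled only on [0, T].\<close>
  define v where "v = (\<lambda>r. if r \<in> {0..T} then u r else 0)"
  have [measurable]: "e \<in> borel_measurable borel" unfolding e_def by measurable
  have [measurable]: "v \<in> borel_measurable borel"
    unfolding v_def by (intro borel_measurable_continuous_on_if u_cont) auto
  have e_der: "(e has_real_derivative e r / z) (at r)" for r
    unfolding e_def using z by (auto intro!: derivative_eq_intros)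
  have e_le: "\<bar>e r\<bar> \<le> 1" if "r \<in> {0..t}" for r
    using that z by (auto simp: e_def field_simps)
  have "(1 / z)-lipschitz_on {0..t} e"
  proof (rule bounded_derivative_imp_lipschitz)
    show "(e has_derivative (*) (e r / z)) (at r within {0..t})" for r
      using has_field_derivative_at_within[OF e_der] by (simp add: has_field_derivative_def)
    show "onorm ((*) (e r / z)) \<le> 1 / z" if "r \<in> {0..t}" for r
    proof (rule onorm_le)
      have "\<bar>e r\<bar> / z \<le> 1 / z" using e_le[OF that] z by (intro divide_right_mono) auto
      then show "norm (e r / z * h) \<le> 1 / z * norm h" for h
        using z mult_right_mono[of "\<bar>e r\<bar> / z" "1 / z" "\<bar>h\<bar>"] by (simp add: abs_mult)
    qed
  qed (use z in auto)
  moreover have lip_t: "L-lipschitz_on {0..t} u"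
    using lip by (rule lipschitz_on_subset) (use t in auto)
  moreover have "\<bar>u r\<bar> \<le> L * t" if "r \<in> {0..t}" for r
  proof -
    have "\<bar>u r\<bar> \<le> L * r" using lipschitz_onD[OF lip_t that, of 0] t that by (simp add: u_0 dist_real_def)
    also have "\<dots> \<le> L * t" using that L_nonneg by (intro mult_left_mono) auto
    finally show ?thesis .
  qed
  ultimately have lip_eu: "(1 * L + L * t * (1 / z))-lipschitz_on {0..t} (\<lambda>r. e r * u r)"
    using e_le t L_nonneg by (intro lipschitz_on_mult_bounded) auto
  have FTC: "(LINT r:{0..t}|lborel. e r * w r + e r / z * v r) = e t * u t - e 0 * u 0"
  proof (rule lipschitz_on_real_FTC(2)[OF _ lip_eu])
    show "AE r in lborel. r \<in> {0<..<t} \<longrightarrow>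
      ((\<lambda>r. e r * u r) has_real_derivative e r * w r + e r / z * v r) (at r)"
      using rate_AE
    proof eventually_elim
      case (elim r)
      then show ?case
        using DERIV_mult[OF e_der[of r], of u "w r"] t by (auto simp: v_def algebra_simps)
    qed
  qed (use t in auto)
  have ew_int: "set_integrable lborel {0..t} (\<lambda>r. e r * w r)"
    unfolding e_def by (rule exp_memory_integrable[OF _ rate_bound z]) measurable
  have eu_int: "set_integrable lborel {0..t} (\<lambda>r. e r / z * u r)"
    unfolding e_def using u_cont z t
    by (intro borel_integrable_atLeastAtMost' continuous_intros) (auto elim: continuous_on_subset)
  have ev_int: "set_integrable lborel {0..t} (\<lambda>r. e r / z * v r)"
    using eu_int by (rule set_integrable_cong[THEN iffD1, rotated 3]) (use t in \<open>auto simp: v_def\<close>)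
  have "(LINT r:{0..t}|lborel. e r / z * v r) = (LINT r:{0..t}|lborel. e r / z * u r)"
    by (rule set_lebesgue_integral_cong) (use t in \<open>auto simp: v_def\<close>)
  also have "\<dots> = delay t z"
  proof -
    have "e r = exp (- t / z) * exp (r / z)" for r
      unfolding e_def exp_add[symmetric] by (simp add: diff_divide_distrib)
    then have eq: "e r / z * u r = exp (- t / z) / z * (exp (r / z) * u r)" for r
      by simp
    show ?thesis
      unfolding set_borel_integral_eq_integral(2)[OF eu_int] unfolding eq delay_def by simp
  qed
  finally have "(LINT r:{0..t}|lborel. e r * w r) + delay t z = u t"
    using FTC set_integral_add(2)[OF ew_int ev_int] by (simp add: u_0) (simp add: e_def)
  then show ?thesis
    using t by (simp add: memory_eq e_def)
qed

text \<open>Continuity of \<open>u\<close> suffices at every interior time. The product rule yields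
  \<open>(u t - delay t z) / z\<close>, which is the memory variable divided by
  \<open>z\<close>.\<close>

lemma delay_has_derivative:
  assumes t: "t \<in> {0<..<T}" and z: "0 < z"
  shows "((\<lambda>s. delay s z) has_real_derivative memory u t z / z) (at t)"
proof -
  have "continuous_on {0..T} (\<lambda>r. exp (r / z) * u r)"
    using z by (intro continuous_intros u_cont) auto
  then have "((\<lambda>s. integral {0..s} (\<lambda>r. exp (r / z) * u r)) has_real_derivative exp (t / z) * u t) (at t within {0..T})"
    by (rule integral_has_real_derivative) (use t in auto)
  then have I: "((\<lambda>s. integral {0..s} (\<lambda>r. exp (r / z) * u r)) has_real_derivative exp (t / z) * u t) (at t)"
    using t by (simp add: at_within_Icc_at)
  have E: "((\<lambda>s. exp (- s / z) / z) has_real_derivative - exp (- t / z) / z / z) (at t)"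
    using z by (auto intro!: derivative_eq_intros)
  have "exp (t / z) * exp (- t / z) = 1"
    by (simp flip: exp_add)
  then have "(- exp (- t / z) / z / z) * integral {0..t} (\<lambda>r. exp (r / z) * u r) + exp (t / z) * u t * (exp (- t / z) / z)
    = memory u t z / z"
    using t z by (simp add: memory_by_parts delay_def diff_divide_distrib)
  with DERIV_mult[OF E I] show ?thesis
    by (simp add: delay_def[abs_def])
qed

lemma memory_has_derivative:
  assumes t: "t \<in> {0<..<T}" and z: "0 < z" and diff: "u differentiable at t"
  shows "((\<lambda>s. memory u s z) has_real_derivative deriv u t - memory u t z / z) (at t)"
proof -
  have "((\<lambda>s. u s - delay s z) has_real_derivative deriv u t - memory u t z / z) (at t)"
    using diff delay_has_derivative[OF t z]
    by (intro DERIV_diff) (simp_all add: DERIV_deriv_iff_real_differentiable)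
  then show ?thesis
    by (rule has_field_derivative_transform_within_open[where S="{0<..<T}"])
       (use t z in \<open>auto simp: memory_by_parts\<close>)
qed

text \<open>One \<open>L\<close> comes from \<open>u\<close>, the other from \<open>delay\<close>,
  whose rate \<open>memory u r z / z\<close> is bounded by \<open>L\<close> because the memory
  variable is at most \<open>L * z\<close>. The constant is thus uniform in
  \<open>z\<close>.\<close>

lemma memory_lipschitz:
  assumes s: "s \<in> {0<..<T}" and t: "t \<in> {0<..<T}" and z: "0 < z"
  shows "\<bar>memory u s z - memory u t z\<bar> \<le> 2 * L * \<bar>s - t\<bar>"
proof -
  have "\<bar>u s - u t\<bar> \<le> L * \<bar>s - t\<bar>"
    using lipschitz_onD[OF lip, of s t] s t by (simp add: dist_real_def)
  moreover have "norm (delay s z - delay t z) \<le> L * norm (s - t)"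
  proof (rule field_differentiable_bound[where S="{0<..<T}" and f'="\<lambda>r. memory u r z / z"])
    show "norm (memory u r z / z) \<le> L" if "r \<in> {0<..<T}" for r
    proof -
      have "\<bar>memory u r z\<bar> \<le> L * min r z" using that z by (intro memory_bound) auto
      also have "\<dots> \<le> L * z" using L_nonneg by (intro mult_left_mono) auto
      finally show ?thesis using z by (simp add: field_simps)
    qed
  qed (use s t z delay_has_derivative in \<open>auto intro: has_field_derivative_at_within\<close>)
  moreover have "memory u s z - memory u t z = (u s - u t) - (delay s z - delay t z)"
    using s t z by (simp add: memory_by_parts)
  ultimately show ?thesis by simp
qed

end

lemma state_variable_history:
  assumes "state_variable T u"
  obtains L w where "lipschitz_history T L u w"
proof -
  obtain L w where "L-lipschitz_on {0..T} u" "w \<in> borel_measurable borel"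
    "\<And>x. \<bar>w x\<bar> \<le> L" "\<And>x. x \<in> {0<..<T} \<Longrightarrow> u differentiable at x \<Longrightarrow> deriv u x = w x"
    "AE x in lborel. x \<in> {0..T} \<longrightarrow> (u has_real_derivative w x) (at x)"
    using state_variable_rate[OF assms] by blast
  moreover have "u 0 = 0" using assms by (simp add: state_variable_def)
  ultimately have "lipschitz_history T L u w" by unfold_locales auto
  then show ?thesis by (rule that)
qed

section \<open>Rate of the stored energy\<close>

lemma set_integral_lebesgue_eq_lborel:
  fixes h :: "real \<Rightarrow> real"
  assumes [measurable]: "h \<in> borel_measurable borel" "A \<in> sets borel"
  shows "(LINT z:A|lebesgue. h z) = (LINT z:A|lborel. h z)"
  unfolding set_lebesgue_integral_def by (rule integral_completion) measurable

text \<open>Reduces integrability over \<open>z\<close> to a bound by a multiple of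
  \<open>min T z\<close>, the form in which the memory variable is estimated.\<close>

lemma relaxation_spectrum_dominated_integrable:
  assumes C: "0 < C" and \<beta>: "\<beta> \<in> {0<..<1}" and T: "0 < T"
    and [measurable]: "h \<in> borel_measurable borel"
    and h: "\<And>z. 0 < z \<Longrightarrow> \<bar>h z\<bar> \<le> B * min T z"
  shows "set_integrable lborel {0<..} (\<lambda>z. relaxation_spectrum C \<beta> z * h z)"
proof -
  have "set_integrable lborel {0<..} (\<lambda>z. B * (relaxation_spectrum C \<beta> z * min T z))"
    by (intro set_integrable_mult_right relaxation_spectrum_min_integrable \<beta> T)
  then show ?thesis
    unfolding set_integrable_def
  proof (rule Bochner_Integration.integrable_bound)
    have "\<bar>relaxation_spectrum C \<beta> z * h z\<bar> \<le> \<bar>B * (relaxation_spectrum C \<beta> z * min T z)\<bar>" if "0 < z" for z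
    proof -
      have "\<bar>relaxation_spectrum C \<beta> z * h z\<bar> = relaxation_spectrum C \<beta> z * \<bar>h z\<bar>"
        by (simp add: abs_mult relaxation_spectrum_nonneg[OF C \<beta>])
      also have "\<dots> \<le> relaxation_spectrum C \<beta> z * (B * min T z)"
        by (intro mult_left_mono h that relaxation_spectrum_nonneg C \<beta>)
      also have "\<dots> \<le> \<bar>B * (relaxation_spectrum C \<beta> z * min T z)\<bar>"
        by (simp only: mult.left_commute abs_ge_self)
      finally show ?thesis .
    qed
    then show "AE z in lborel. norm (indicator {0<..} z *\<^sub>R (relaxation_spectrum C \<beta> z * h z))
        \<le> norm (indicator {0<..} z *\<^sub>R (B * (relaxation_spectrum C \<beta> z * min T z)))"
      by (intro AE_I2) (simp add: indicator_def)
  qed measurable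
qed

context lipschitz_history
begin

text \<open>Integrating over \<open>z\<close> first leaves the exponential integral of the spectrum,
  which is the Caputo kernel in \<open>t - r\<close>.\<close>

lemma relaxation_spectrum_memory_integral:
  assumes C: "0 < C" and \<beta>: "\<beta> \<in> {0<..<1}" and t: "0 < t" "t \<le> T"
  shows "(LINT z:{0<..}|lborel. relaxation_spectrum C \<beta> z * memory u t z) = C * caputo \<beta> u t"
proof -
  let ?S = "relaxation_spectrum C \<beta>"
  define f where "f = (\<lambda>z r. indicator {0<..} z * ?S z * (indicator {0..t} r * (exp (- (t - r) / z) * w r)))"
  have [measurable]: "case_prod f \<in> borel_measurable (lborel \<Otimes>\<^sub>M lborel)"
    unfolding f_def by measurable
  have inner: "(LINT r|lborel. indicator {0..t} r * (exp (- (t - r) / z) * v r)) =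
      (LINT r:{0..t}|lborel. exp (- (t - r) / z) * v r)" for z and v :: "real \<Rightarrow> real"
    by (simp add: set_lebesgue_integral_def)
  have "integrable (lborel \<Otimes>\<^sub>M lborel) (case_prod f)"
  proof (rule lborel_pair.Fubini_integrable)
    have norm_f: "norm (case_prod f (z, r)) = indicator {0<..} z * ?S z *
        (indicator {0..t} r * (exp (- (t - r) / z) * \<bar>w r\<bar>))" for z r
      by (simp add: f_def abs_mult relaxation_spectrum_nonneg[OF C \<beta>])
    \<comment> \<open>The inner integral of the modulus is the memory integral of
      \<open>\<bar>w\<bar>\<close>, so the same bound by \<open>L * min t z\<close> gives absolute
      integrability on the plane.\<close>
    have "set_integrable lborel {0<..} (\<lambda>z. ?S z * (LINT r:{0..t}|lborel. exp (- (t - r) / z) * \<bar>w r\<bar>))"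
    proof (rule relaxation_spectrum_dominated_integrable[OF C \<beta> t(1)])
      show "\<bar>LINT r:{0..t}|lborel. exp (- (t - r) / z) * \<bar>w r\<bar>\<bar> \<le> L * min t z" if "0 < z" for z
        by (rule exp_memory_bound) (use t that rate_bound in simp_all)
    qed measurable
    then show "integrable lborel (\<lambda>z. LINT r|lborel. norm (case_prod f (z, r)))"
      unfolding norm_f integral_mult_right_zero inner by (simp add: set_integrable_def ac_simps)
    have "integrable lborel (\<lambda>r. f z r)" for z
    proof (cases "0 < z")
      case True
      from exp_memory_integrable[OF rate_measurable rate_bound this, of t] show ?thesis
        unfolding f_def set_integrable_def by (intro integrable_mult_right) simp
    qed (simp add: f_def)
    then show "AE z in lborel. integrable lborel (\<lambda>r. case_prod f (z, r))"
      by simp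
  qed measurable
  from lborel_pair.Fubini_integral[OF this]
  have "(LINT z|lborel. LINT r|lborel. f z r) = (LINT r|lborel. LINT z|lborel. f z r)" by simp
  moreover have "(LINT z|lborel. LINT r|lborel. f z r) = (LINT z:{0<..}|lborel. ?S z * memory u t z)"
    unfolding f_def integral_mult_right_zero inner
    using t by (simp add: set_lebesgue_integral_def memory_eq ac_simps)
  moreover have "(LINT r|lborel. LINT z|lborel. f z r) =
      (LINT r:{0..t}|lborel. C / Gamma (1 - \<beta>) * ((t - r) powr (- \<beta>) * w r))"
    unfolding set_lebesgue_integral_def
  proof (rule integral_cong_AE)
    \<comment> \<open>The point \<open>r = t\<close> is excluded because the exponential integral is
      evaluated only for a positive time lag; it is a null set.\<close>
    have inner_z: "(LINT z|lborel. f z r) = indicator {0..t} r *\<^sub>R (C / Gamma (1 - \<beta>) * ((t - r) powr (- \<beta>) * w r))"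
      if "r \<noteq> t" for r
    proof (cases "r \<in> {0..t}")
      case True
      then have "0 < t - r" using that by auto
      have "(LINT z|lborel. f z r) = (LINT z|lborel. w r * (indicator {0<..} z * (?S z * exp (- (t - r) / z))))"
        using True by (simp add: f_def ac_simps)
      also have "\<dots> = w r * (LINT z:{0<..}|lborel. ?S z * exp (- (t - r) / z))"
        by (simp add: set_lebesgue_integral_def)
      finally show ?thesis
        using True relaxation_spectrum_exp_integral[OF \<beta> \<open>0 < t - r\<close>] by simp
    qed (simp add: f_def)
    show "AE r in lborel. (LINT z|lborel. f z r) =
        indicator {0..t} r *\<^sub>R (C / Gamma (1 - \<beta>) * ((t - r) powr (- \<beta>) * w r))"
      using AE_lborel_singleton[of t] by eventually_elim (rule inner_z)
  qed measurable
  ultimately show ?thesis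
    using t by (simp add: caputo_eq)
qed

text \<open>Dominated convergence applied to the difference quotients of the squared memory
  variable; the Maxwell equation then splits the limit into the power of the Caputo stress and the
  dissipation.\<close>

lemma viscous_energy_has_derivative:
  assumes C: "0 < C" and \<beta>: "\<beta> \<in> {0<..<1}" and t: "t \<in> {0<..<T}" and diff: "u differentiable at t"
  shows "((\<lambda>s. 1/2 * (LINT z:{0<..}|lebesgue. relaxation_spectrum C \<beta> z * (memory u s z)\<^sup>2))
    has_real_derivative C * caputo \<beta> u t * deriv u t - mech_dissipation C \<beta> u t) (at t)"
proof -
  let ?S = "relaxation_spectrum C \<beta>"
  have T: "0 < T" using t by auto
  have [measurable]: "memory u s \<in> borel_measurable borel" if "s \<in> {0<..<T}" for s
    using that by (intro memory_measurable) auto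
  have bound_T: "\<bar>memory u s z\<bar> \<le> L * T" and bound_z: "\<bar>memory u s z\<bar> \<le> L * z"
    and bound: "\<bar>memory u s z\<bar> \<le> L * min T z"
    if "s \<in> {0<..<T}" "0 < z" for s z
  proof -
    have *: "\<bar>memory u s z\<bar> \<le> L * min s z" using that by (intro memory_bound) auto
    have "L * min s z \<le> L * min T z" "L * min T z \<le> L * T" "L * min T z \<le> L * z"
      using that L_nonneg by (auto intro!: mult_left_mono)
    with * show "\<bar>memory u s z\<bar> \<le> L * min T z" "\<bar>memory u s z\<bar> \<le> L * T" "\<bar>memory u s z\<bar> \<le> L * z"
      by linarith+
  qed
  define F where "F = (\<lambda>s. LINT z:{0<..}|lborel. ?S z * (memory u s z)\<^sup>2)"
  \<comment> \<open>One factor of the square is bounded by \<open>L * T\<close>, the other by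
    \<open>L * min T z\<close>.\<close>
  have F_int: "set_integrable lborel {0<..} (\<lambda>z. ?S z * (memory u s z)\<^sup>2)" if s: "s \<in> {0<..<T}" for s
  proof (rule relaxation_spectrum_dominated_integrable[OF C \<beta> T, where B="L * T * L"])
    fix z :: real assume z: "0 < z"
    have "\<bar>memory u s z\<bar> * \<bar>memory u s z\<bar> \<le> L * T * (L * min T z)"
      using bound_T[OF s z] bound[OF s z] by (intro mult_mono) (auto simp: L_nonneg T less_imp_le)
    then show "\<bar>(memory u s z)\<^sup>2\<bar> \<le> L * T * L * min T z"
      by (simp add: power2_eq_square abs_mult ac_simps)
  qed (use s in measurable)
  have int_m: "set_integrable lborel {0<..} (\<lambda>z. ?S z * memory u t z)"
    by (rule relaxation_spectrum_dominated_integrable[OF C \<beta> T _ bound[OF t]]) (use t in measurable)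
  \<comment> \<open>Here one factor is bounded by \<open>L * z\<close>, which absorbs the division
    by \<open>z\<close>.\<close>
  have int_diss: "set_integrable lborel {0<..} (\<lambda>z. ?S z * ((memory u t z)\<^sup>2 / z))"
  proof (rule relaxation_spectrum_dominated_integrable[OF C \<beta> T, where B="L * L"])
    fix z :: real assume z: "0 < z"
    have "\<bar>memory u t z\<bar> * \<bar>memory u t z\<bar> \<le> L * z * (L * min T z)"
      using bound_z[OF t z] bound[OF t z] z T by (intro mult_mono) (auto simp: L_nonneg)
    then show "\<bar>(memory u t z)\<^sup>2 / z\<bar> \<le> L * L * min T z"
      using z by (simp add: power2_eq_square abs_mult field_simps)
  qed (use t in measurable)
  define G where "G = (\<lambda>z. ?S z * (2 * memory u t z * (deriv u t - memory u t z / z)))"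
  have "(F has_real_derivative (LINT z:{0<..}|lborel. G z)) (at t within {0<..<T})"
    \<comment> \<open>Convergence is tested along arbitrary sequences in the interval that avoid
      \<open>t\<close>, the setting of dominated convergence.\<close>
    unfolding has_field_derivative_iff tendsto_at_iff_sequentially comp_def
  proof (intro allI impI)
    fix X :: "nat \<Rightarrow> real" assume X: "\<forall>i. X i \<in> {0<..<T} - {t}" and X_lim: "X \<longlonglongrightarrow> t"
    have X_in: "X n \<in> {0<..<T}" "X n \<noteq> t" for n using X by auto
    define Q where "Q = (\<lambda>n z. ((memory u (X n) z)\<^sup>2 - (memory u t z)\<^sup>2) / (X n - t))"
    have [measurable]: "Q n \<in> borel_measurable borel" for n
      unfolding Q_def using X_in(1)[of n] t by measurable
    have "(F (X n) - F t) / (X n - t) = (LINT z|lborel. indicator {0<..} z *\<^sub>R (?S z * Q n z))" for n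
    proof -
      have diff_F: "F (X n) - F t = (LINT z:{0<..}|lborel. ?S z * (memory u (X n) z)\<^sup>2 - ?S z * (memory u t z)\<^sup>2)"
        unfolding F_def by (intro set_integral_diff(2)[symmetric] F_int X_in t)
      have "(F (X n) - F t) / (X n - t) =
          (LINT z:{0<..}|lborel. (?S z * (memory u (X n) z)\<^sup>2 - ?S z * (memory u t z)\<^sup>2) / (X n - t))"
        unfolding diff_F by simp
      then show ?thesis
        unfolding set_lebesgue_integral_def Q_def right_diff_distrib[symmetric] times_divide_eq_right .
    qed
    moreover have "(\<lambda>n. LINT z|lborel. indicator {0<..} z *\<^sub>R (?S z * Q n z)) \<longlonglongrightarrow>
        (LINT z|lborel. indicator {0<..} z *\<^sub>R G z)"
    proof (rule integral_dominated_convergence)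
      have "set_integrable lborel {0<..} (\<lambda>z. ?S z * (4 * L * L * min T z))"
        by (rule relaxation_spectrum_dominated_integrable[OF C \<beta> T, where B="4 * L * L"])
           (use L_nonneg T in \<open>auto simp: abs_mult\<close>)
      then show "integrable lborel (\<lambda>z. indicator {0<..} z *\<^sub>R (?S z * (4 * L * L * min T z)))"
        by (simp add: set_integrable_def)
      \<comment> \<open>In the factored difference of squares, the difference is at most
        \<open>2 * L * \<bar>X n - t\<bar>\<close> and cancels the denominator; the sum is at most
        \<open>2 * L * min T z\<close>.\<close>
      have "\<bar>Q n z\<bar> \<le> 4 * L * L * min T z" if z: "0 < z" for n z
      proof -
        have "\<bar>(memory u (X n) z)\<^sup>2 - (memory u t z)\<^sup>2\<bar> =
            \<bar>memory u (X n) z - memory u t z\<bar> * \<bar>memory u (X n) z + memory u t z\<bar>"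
          by (simp add: power2_eq_square square_diff_square_factored abs_mult ac_simps)
        also have "\<dots> \<le> (2 * L * \<bar>X n - t\<bar>) * (2 * (L * min T z))"
          using memory_lipschitz[OF X_in(1) t z, of n] bound[OF X_in(1) z, of n] bound[OF t z] L_nonneg
          by (intro mult_mono) auto
        finally show ?thesis
          using X_in(2)[of n] by (simp add: Q_def abs_divide divide_le_eq ac_simps)
      qed
      then have "\<bar>?S z * Q n z\<bar> \<le> ?S z * (4 * L * L * min T z)" if "0 < z" for n z
        using that relaxation_spectrum_nonneg[OF C \<beta>, of z] by (simp add: abs_mult mult_left_mono)
      then show "AE z in lborel. norm (indicator {0<..} z *\<^sub>R (?S z * Q n z))
          \<le> indicator {0<..} z *\<^sub>R (?S z * (4 * L * L * min T z))" for n
        by (intro AE_I2) (simp add: indicator_def)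
      have "(\<lambda>n. Q n z) \<longlonglongrightarrow> 2 * memory u t z * (deriv u t - memory u t z / z)" if z: "0 < z" for z
      proof -
        have "((\<lambda>s. (memory u s z)\<^sup>2) has_real_derivative
            2 * memory u t z * (deriv u t - memory u t z / z)) (at t within {0<..<T})"
          using memory_has_derivative[OF t z diff, THEN DERIV_subset]
          by (auto intro!: derivative_eq_intros)
        then show ?thesis
          unfolding has_field_derivative_iff tendsto_at_iff_sequentially comp_def Q_def
          using X X_lim by blast
      qed
      then show "AE z in lborel. (\<lambda>n. indicator {0<..} z *\<^sub>R (?S z * Q n z)) \<longlonglongrightarrow> indicator {0<..} z *\<^sub>R G z"
        by (intro AE_I2) (auto simp: indicator_def G_def intro!: tendsto_mult_left)
    qed (use t in \<open>simp_all add: G_def\<close>)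
    ultimately show "(\<lambda>n. (F (X n) - F t) / (X n - t)) \<longlonglongrightarrow> (LINT z:{0<..}|lborel. G z)"
      by (simp add: set_lebesgue_integral_def)
  qed
  then have F_der: "(F has_real_derivative (LINT z:{0<..}|lborel. G z)) (at t)"
    by (simp only: at_within_open[OF t open_greaterThanLessThan])
  have diss: "mech_dissipation C \<beta> u t = (LINT z:{0<..}|lborel. ?S z * ((memory u t z)\<^sup>2 / z))"
    unfolding mech_dissipation_def using t
    by (subst set_integral_lebesgue_eq_lborel) auto
  have "(LINT z:{0<..}|lborel. G z) =
      (LINT z:{0<..}|lborel. 2 * deriv u t * (?S z * memory u t z) - 2 * (?S z * ((memory u t z)\<^sup>2 / z)))"
    by (rule set_lebesgue_integral_cong) (auto simp: G_def power2_eq_square algebra_simps)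
  also have "\<dots> = 2 * deriv u t * (C * caputo \<beta> u t) - 2 * mech_dissipation C \<beta> u t"
  proof -
    have "(LINT z:{0<..}|lborel. ?S z * memory u t z) = C * caputo \<beta> u t"
      using t by (intro relaxation_spectrum_memory_integral[OF C \<beta>]) auto
    then show ?thesis
      by (simp only: set_integral_diff(2)[OF set_integrable_mult_right set_integrable_mult_right]
          int_m int_diss set_integral_mult_right diss)
  qed
  finally have "1/2 * (LINT z:{0<..}|lborel. G z) = C * caputo \<beta> u t * deriv u t - mech_dissipation C \<beta> u t"
    by simp
  then have "((\<lambda>s. 1/2 * F s) has_real_derivative C * caputo \<beta> u t * deriv u t - mech_dissipation C \<beta> u t) (at t)"
    using DERIV_cmult[OF F_der, of "1/2"] by (simp only:)
  then show ?thesis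
  proof (rule has_field_derivative_transform_within_open[where S="{0<..<T}"])
    show "1/2 * F s = 1/2 * (LINT z:{0<..}|lebesgue. ?S z * (memory u s z)\<^sup>2)" if "s \<in> {0<..<T}" for s
      unfolding F_def using that by (subst set_integral_lebesgue_eq_lborel) auto
  qed (use t in auto)
qed

end

lemma mech_dissipation_nonneg:
  assumes "0 < C" "\<beta> \<in> {0<..<1}"
  shows "0 \<le> mech_dissipation C \<beta> u t"
  unfolding mech_dissipation_def set_lebesgue_integral_def
  by (intro integral_nonneg_AE AE_I2)
     (auto simp: indicator_def relaxation_spectrum_nonneg[OF assms])

lemma viscous_energy_nonneg:
  assumes "0 < C" "\<beta> \<in> {0<..<1}"
  shows "0 \<le> 1/2 * (LINT z:{0<..}|lebesgue. relaxation_spectrum C \<beta> z * (memory u t z)\<^sup>2)"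
  unfolding set_lebesgue_integral_def
  by (intro mult_nonneg_nonneg integral_nonneg_AE AE_I2)
     (auto simp: indicator_def relaxation_spectrum_nonneg[OF assms])

section \<open>The dissipation inequality\<close>

theorem theorem4p9:
  fixes E K H \<tau>Y S s \<beta>E \<beta>K T :: real
    and \<epsilon> eve evp \<alpha> \<gamma> D \<tau> R f :: "real \<Rightarrow> real"
  defines "reg \<equiv> regular_times T {\<epsilon>, eve, evp, \<alpha>, \<gamma>, D}"
    and "\<psi> \<equiv> helmholtz E \<beta>E K \<beta>K H eve \<alpha> D"
    and "Y \<equiv> release_rate E \<beta>E K \<beta>K H eve \<alpha>"
  assumes constants: "E > 0" "K > 0" "H > 0" "\<tau>Y > 0" "S > 0" "s > 0"
    and orders: "\<beta>E \<in> {0<..<1}" "\<beta>K \<in> {0<..<1}"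
    and horizon: "T > 0"
    and state: "\<And>u. u \<in> {\<epsilon>, eve, evp, \<alpha>, \<gamma>, D} \<Longrightarrow> state_variable T u"
    and hardening_nonneg: "\<And>t. t \<in> {0..T} \<Longrightarrow> \<alpha> t \<ge> 0"
    and damage_range: "\<And>t. t \<in> {0..T} \<Longrightarrow> D t \<in> {0..<1}"
    and damage_mono: "mono_on {0..T} D"
    and strain_decomposition: "\<And>t. t \<in> {0..T} \<Longrightarrow> \<epsilon> t = eve t + evp t"
    and stress_strain:
      "\<And>t. t \<in> {0..T} \<Longrightarrow> \<tau> t = (1 - D t) * (E * caputo \<beta>E (\<lambda>r. \<epsilon> r - evp r) t)"
    and accumulated_stress:
      "\<And>t. t \<in> {0..T} \<Longrightarrow> R t = (1 - D t) * (K * caputo \<beta>K \<alpha> t + H * \<alpha> t)"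
    and yield_function:
      "\<And>t. t \<in> {0..T} \<Longrightarrow> f t = \<bar>\<tau> t\<bar> - ((1 - D t) * \<tau>Y + R t)"
    and evolution_evp: "\<And>t. t \<in> reg \<Longrightarrow> deriv evp t = sgn (\<tau> t) * deriv \<gamma> t"
    and evolution_alpha: "\<And>t. t \<in> reg \<Longrightarrow> deriv \<alpha> t = deriv \<gamma> t"
    and evolution_damage:
      "\<And>t. t \<in> reg \<Longrightarrow>
         deriv D t = deriv \<gamma> t / (1 - D t) * (- release_ve E \<beta>E eve t / S) powr s"
    and slip_rate_nonneg: "\<And>t. t \<in> reg \<Longrightarrow> deriv \<gamma> t \<ge> 0"
    and yield_admissible: "\<And>t. t \<in> {0..T} \<Longrightarrow> f t \<le> 0"
    and complementarity: "\<And>t. t \<in> reg \<Longrightarrow> f t * deriv \<gamma> t = 0"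
  shows "(\<forall>t\<in>reg.
            \<psi> differentiable at t \<and>
            clausius_duhem_lhs \<psi> \<tau> \<epsilon> t =
              (1 - D t) * (\<tau>Y * deriv \<gamma> t + mech_dissipation E \<beta>E eve t + mech_dissipation K \<beta>K \<alpha> t)
              - Y t * deriv D t \<and>
            (1 - D t) * (\<tau>Y * deriv \<gamma> t + mech_dissipation E \<beta>E eve t + mech_dissipation K \<beta>K \<alpha> t)
              - Y t * deriv D t \<ge> 0)
         \<and> thermodynamically_admissible reg \<psi> \<tau> \<epsilon>"
proof -
  \<comment> \<open>The stress law is stated for the strain difference. It coincides with
    \<open>eve\<close> on [0, T], and the Caputo derivative at \<open>t\<close> involves only rates
    between 0 and \<open>t\<close>.\<close>
  have caputo_eve: "caputo \<beta>E (\<lambda>r. \<epsilon> r - evp r) t = caputo \<beta>E eve t" if t: "t \<in> {0..T}" for t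
  proof -
    obtain L w where "lipschitz_history T L eve w"
      using state_variable_history[OF state[of eve]] by auto
    then interpret lipschitz_history T L eve w .
    show ?thesis
      using t strain_decomposition caputo_eq[of t "\<lambda>r. \<epsilon> r - evp r" \<beta>E] caputo_eq[of t eve \<beta>E] by auto
  qed
  have main: "\<psi> differentiable at t \<and> \<epsilon> differentiable at t \<and>
      clausius_duhem_lhs \<psi> \<tau> \<epsilon> t =
        (1 - D t) * (\<tau>Y * deriv \<gamma> t + mech_dissipation E \<beta>E eve t + mech_dissipation K \<beta>K \<alpha> t)
        - Y t * deriv D t \<and>
      (1 - D t) * (\<tau>Y * deriv \<gamma> t + mech_dissipation E \<beta>E eve t + mech_dissipation K \<beta>K \<alpha> t)
        - Y t * deriv D t \<ge> 0" if t_reg: "t \<in> reg" for t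
  proof -
    have t: "t \<in> {0<..<T}" and diff: "u differentiable at t" if "u \<in> {\<epsilon>, eve, evp, \<alpha>, \<gamma>, D}" for u
      using t_reg that by (auto simp: reg_def regular_times_def)
    have t_cl: "t \<in> {0..T}" using t[of \<epsilon>] by auto
    have der: "(u has_real_derivative deriv u t) (at t)" if "u \<in> {\<epsilon>, eve, evp, \<alpha>, \<gamma>, D}" for u
      using diff[OF that] by (simp add: DERIV_deriv_iff_real_differentiable)
    obtain L w where "lipschitz_history T L eve w"
      using state_variable_history[OF state[of eve]] by auto
    then have ve: "(psi_ve E \<beta>E eve has_real_derivative
        E * caputo \<beta>E eve t * deriv eve t - mech_dissipation E \<beta>E eve t) (at t)"
      unfolding psi_ve_def[abs_def]
      using lipschitz_history.viscous_energy_has_derivative[OF _ constants(1) orders(1) t diff, of L eve w] by auto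
    obtain L' w' where "lipschitz_history T L' \<alpha> w'"
      using state_variable_history[OF state[of \<alpha>]] by auto
    then have "((\<lambda>s. 1/2 * (LINT z:{0<..}|lebesgue. relaxation_spectrum K \<beta>K z * (memory \<alpha> s z)\<^sup>2))
        has_real_derivative K * caputo \<beta>K \<alpha> t * deriv \<alpha> t - mech_dissipation K \<beta>K \<alpha> t) (at t)"
      using lipschitz_history.viscous_energy_has_derivative[OF _ constants(2) orders(2) t diff, of L' \<alpha> w'] by auto
    moreover have "((\<lambda>s. 1/2 * H * (\<alpha> s)\<^sup>2) has_real_derivative H * \<alpha> t * deriv \<alpha> t) (at t)"
      by (auto intro!: derivative_eq_intros der)
    ultimately have vp: "(psi_vp K \<beta>K H \<alpha> has_real_derivative
        K * caputo \<beta>K \<alpha> t * deriv \<alpha> t - mech_dissipation K \<beta>K \<alpha> t + H * \<alpha> t * deriv \<alpha> t) (at t)"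
      unfolding psi_vp_def[abs_def] by (rule DERIV_add)
    \<comment> \<open>The last term, the damage rate times the undamaged energy, becomes
      \<open>- Y t * deriv D t\<close> in the dissipation.\<close>
    have psi: "(\<psi> has_real_derivative
        (1 - D t) * (E * caputo \<beta>E eve t * deriv eve t - mech_dissipation E \<beta>E eve t +
          (K * caputo \<beta>K \<alpha> t * deriv \<alpha> t - mech_dissipation K \<beta>K \<alpha> t + H * \<alpha> t * deriv \<alpha> t))
        - deriv D t * (psi_ve E \<beta>E eve t + psi_vp K \<beta>K H \<alpha> t)) (at t)"
      unfolding \<psi>_def helmholtz_def[abs_def]
      by (rule derivative_eq_intros der ve vp refl | simp)+
    have "((\<lambda>s. eve s + evp s) has_real_derivative deriv eve t + deriv evp t) (at t)"
      by (intro DERIV_add der) auto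
    then have "(\<epsilon> has_real_derivative deriv eve t + deriv evp t) (at t)"
      by (rule has_field_derivative_transform_within_open[where S="{0<..<T}"])
         (use t[of \<epsilon>] strain_decomposition in auto)
    then have eps: "deriv \<epsilon> t = deriv eve t + deriv evp t"
      by (rule DERIV_imp_deriv)
    have tau: "\<tau> t = (1 - D t) * (E * caputo \<beta>E eve t)"
      using stress_strain[OF t_cl] caputo_eve[OF t_cl] by simp
    \<comment> \<open>Along the flow direction \<open>sgn (\<tau> t)\<close> the plastic power is
      \<open>\<bar>\<tau> t\<bar> * deriv \<gamma> t\<close>. Complementarity allows the yield
      stress to replace \<open>\<bar>\<tau> t\<bar>\<close> whenever slip occurs.\<close>
    have plastic_power: "\<tau> t * deriv evp t = ((1 - D t) * \<tau>Y + R t) * deriv \<gamma> t"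
    proof -
      have "\<tau> t * deriv evp t = \<bar>\<tau> t\<bar> * deriv \<gamma> t"
        by (simp add: evolution_evp[OF t_reg] abs_sgn)
      also have "\<dots> = ((1 - D t) * \<tau>Y + R t) * deriv \<gamma> t"
        using complementarity[OF t_reg] by (simp add: yield_function[OF t_cl] left_diff_distrib)
      finally show ?thesis .
    qed
    have Y: "Y t = - (psi_ve E \<beta>E eve t + psi_vp K \<beta>K H \<alpha> t)"
      by (simp add: Y_def release_rate_def release_ve_def release_vp_def)
    \<comment> \<open>The elastic stress power cancels the Caputo term of the energy rate. The part
      \<open>R t * deriv \<gamma> t\<close> of the plastic power cancels the hardening terms, since
      \<alpha> and \<gamma> have equal rates.\<close>
    have "clausius_duhem_lhs \<psi> \<tau> \<epsilon> t =
        (1 - D t) * (\<tau>Y * deriv \<gamma> t + mech_dissipation E \<beta>E eve t + mech_dissipation K \<beta>K \<alpha> t)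
        - Y t * deriv D t"
      using plastic_power
      by (simp add: clausius_duhem_lhs_def DERIV_imp_deriv[OF psi] eps distrib_left tau Y
          accumulated_stress[OF t_cl] evolution_alpha[OF t_reg] algebra_simps)
    moreover have "(1 - D t) * (\<tau>Y * deriv \<gamma> t + mech_dissipation E \<beta>E eve t + mech_dissipation K \<beta>K \<alpha> t)
        - Y t * deriv D t \<ge> 0"
    proof -
      have D: "D t < 1" using damage_range[OF t_cl] by simp
      have "0 \<le> psi_ve E \<beta>E eve t"
        unfolding psi_ve_def by (rule viscous_energy_nonneg[OF constants(1) orders(1)])
      moreover have "0 \<le> psi_vp K \<beta>K H \<alpha> t"
        unfolding psi_vp_def using constants(3)
        by (intro add_nonneg_nonneg viscous_energy_nonneg[OF constants(2) orders(2)]) auto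
      \<comment> \<open>The sign is read off the evolution law: nonnegative slip rate, positive
        \<open>1 - D t\<close> and a nonnegative power. As the energies are nonnegative,
        \<open>Y t\<close> is at most 0.\<close>
      moreover have "0 \<le> deriv D t"
        using D slip_rate_nonneg[OF t_reg] by (simp add: evolution_damage[OF t_reg])
      ultimately have "Y t * deriv D t \<le> 0"
        unfolding Y by (intro mult_nonpos_nonneg) auto
      moreover have "0 \<le> \<tau>Y * deriv \<gamma> t"
        using constants(4) slip_rate_nonneg[OF t_reg] by simp
      then have "0 \<le> (1 - D t) * (\<tau>Y * deriv \<gamma> t + mech_dissipation E \<beta>E eve t + mech_dissipation K \<beta>K \<alpha> t)"
        using D mech_dissipation_nonneg[OF constants(1) orders(1), of eve t]
          mech_dissipation_nonneg[OF constants(2) orders(2), of \<alpha> t]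
        by (intro mult_nonneg_nonneg) auto
      ultimately show ?thesis by linarith
    qed
    moreover have "\<psi> differentiable at t"
      using psi by (auto simp: real_differentiable_def)
    ultimately show ?thesis
      using diff[of \<epsilon>] by simp
  qed
  then show ?thesis
    by (auto simp: thermodynamically_admissible_def)
qed

end
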